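(* Let $\mathcal{C}=(C_n)_{n\ge1}$ be a stabilizing $\mathrm{Sym}$-invariant chain of finitely generated cones with $C_n\subseteq\mathbb{R}^n_{\ge0}$ for all $n$, and let $r=\mathrm{ind}(\mathcal{C})$. For each $n$ let $C_n^*=\{u\in\mathbb{R}^n:\langle u,v\rangle\ge0 \text{ for all } v\in C_n\}\subseteq\mathbb{R}^n$. Then there exists a finite subset $F_r\subset C_r^*$ such that: (i) every $u=(u_1,\dots,u_r)\in F_r$ satisfies $u_1\le\cdots\le u_r$; (ii) for all $n\ge r$, $$C_n^*=\mathrm{cn}\big(\mathrm{Sym}(n)(F_n\cup\{e_n\})\big),$$ where for $n\ge r+1$, $$F_n=\{(u_1,\dots,u_r,u_r,\dots,u_r)\in\mathbb{R}^n : (u_1,\dots,u_r)\in F_r\}$$ (the last coordinate $u_r$ repeated so that the vector has $n$ coordinates).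
   Context: $\mathbb{R}^n$ is identified with the subspace of sequences $(u_1,\dots,u_n,0,0,\dots)$; $e_i$ denotes the $i$-th standard unit vector. $\mathrm{Sym}(n)$ is the symmetric group on $\{1,\dots,n\}$, acting on $\mathbb{R}^n$ by $\sigma(u)=(u_{\sigma^{-1}(1)},\dots,u_{\sigma^{-1}(n)})$; $\mathrm{Sym}(n)(A)=\{\sigma(a):\sigma\in\mathrm{Sym}(n),a\in A\}$. $\mathrm{cn}(A)$ is the set of finite nonnegative real linear combinations of elements of $A$. A chain of cones $\mathcal{C}=(C_n)_{n\ge1}$ with $C_n\subseteq\mathbb{R}^n$ is $\mathrm{Sym}$-invariant if $\mathrm{cn}(\mathrm{Sym}(n)(C_m))\subseteq C_n$ for all $n\ge m\ge1$. It stabilizes if there is $r$ with $C_n=\mathrm{cn}(\mathrm{Sym}(n)(C_m))$ for all $n\ge m\ge r$; the smallest such $r$ is the stability index $\mathrm{ind}(\mathcal{C})$. $\langle u,v\rangle=\sum_i u_iv_i$. *)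

theory Defs
  imports Complex_Main "HOL-Combinatorics.Permutations"
begin

text \<open>
  Vectors are sequences indexed from 1, so that \<open>\<real>\<close> to the power \<open>m\<close> is literally contained in
  \<open>\<real>\<close> to the power \<open>n\<close> for \<open>m \<le> n\<close>. The type also has an index 0, at which every vector vanishes.
\<close>

definition Rn :: "nat \<Rightarrow> (nat \<Rightarrow> real) set" where
  "Rn n = {u. \<forall>i. i \<notin> {1..n} \<longrightarrow> u i = 0}"

definition Rn_nonneg :: "nat \<Rightarrow> (nat \<Rightarrow> real) set" where
  "Rn_nonneg n = {u \<in> Rn n. \<forall>i\<in>{1..n}. 0 \<le> u i}"

definition unit_vec :: "nat \<Rightarrow> nat \<Rightarrow> real" where
  "unit_vec i = (\<lambda>j. if j = i then 1 else 0)"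

definition Sym :: "nat \<Rightarrow> (nat \<Rightarrow> real) set \<Rightarrow> (nat \<Rightarrow> real) set" where
  "Sym n A = {(\<lambda>i. a (inv \<sigma> i)) | \<sigma> a. \<sigma> permutes {1..n} \<and> a \<in> A}"

text \<open>The empty combination is allowed, so \<open>cn {}\<close> is the zero cone.\<close>

definition cn :: "(nat \<Rightarrow> real) set \<Rightarrow> (nat \<Rightarrow> real) set" where
  "cn A = {(\<lambda>i. \<Sum>a\<in>S. c a * a i) | S c. finite S \<and> S \<subseteq> A \<and> (\<forall>a\<in>S. 0 \<le> c a)}"

definition fg_cone :: "nat \<Rightarrow> (nat \<Rightarrow> real) set \<Rightarrow> bool" where
  "fg_cone n K \<longleftrightarrow> (\<exists>A. finite A \<and> A \<subseteq> Rn n \<and> K = cn A)"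

text \<open>
  A chain is given by the values \<open>C n\<close> for \<open>n \<ge> 1\<close>; nothing below depends on \<open>C 0\<close>.
\<close>

definition sym_invariant :: "(nat \<Rightarrow> (nat \<Rightarrow> real) set) \<Rightarrow> bool" where
  "sym_invariant C \<longleftrightarrow> (\<forall>m n. 1 \<le> m \<and> m \<le> n \<longrightarrow> cn (Sym n (C m)) \<subseteq> C n)"

definition stable_from :: "(nat \<Rightarrow> (nat \<Rightarrow> real) set) \<Rightarrow> nat \<Rightarrow> bool" where
  "stable_from C r \<longleftrightarrow> 1 \<le> r \<and> (\<forall>m n. r \<le> m \<and> m \<le> n \<longrightarrow> C n = cn (Sym n (C m)))"

definition stabilizes :: "(nat \<Rightarrow> (nat \<Rightarrow> real) set) \<Rightarrow> bool" where
  "stabilizes C \<longleftrightarrow> (\<exists>r. stable_from C r)"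

definition stability_index :: "(nat \<Rightarrow> (nat \<Rightarrow> real) set) \<Rightarrow> nat" where
  "stability_index C = (LEAST r. stable_from C r)"

definition dual_cone :: "nat \<Rightarrow> (nat \<Rightarrow> real) set \<Rightarrow> (nat \<Rightarrow> real) set" where
  "dual_cone n K = {u \<in> Rn n. \<forall>v\<in>K. 0 \<le> (\<Sum>i=1..n. u i * v i)}"

definition extend_last :: "nat \<Rightarrow> nat \<Rightarrow> (nat \<Rightarrow> real) \<Rightarrow> nat \<Rightarrow> real" where
  "extend_last r n u = (\<lambda>i. if i \<le> r then u i else if i \<le> n then u r else 0)"

text \<open>For \<open>n = r\<close> the extension changes nothing, so one formula describes \<open>F\<^sub>n\<close> for all \<open>n \<ge> r\<close>.\<close>

lemma extend_last_self: "u \<in> Rn r \<Longrightarrow> extend_last r r u = u"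
  by (auto simp: extend_last_def Rn_def)

end

theory Submission
  imports Defs
begin

text \<open>
  Let \<open>D\<close> be the set of nondecreasing vectors of the dual of \<open>C r\<close>. It is cut out by finitely many
  linear inequalities, so by Minkowski--Weyl (proved here by Motzkin's double description step) it
  is generated by a finite set \<open>F\<close>. A nondecreasing \<open>u\<close> pairs nonnegatively with all rearrangements
  of a nonnegative vector with at most \<open>r\<close> nonzero entries as soon as it does so with those
  supported on the first \<open>r\<close> coordinates, where \<open>u\<close> is smallest. Hence a nondecreasing \<open>u\<close> in
  \<open>Rn n\<close> lies in the dual of \<open>C n\<close> iff its truncation \<open>(u\<^sub>1,\<dots>,u\<^sub>r)\<close> lies in \<open>D\<close>, and such a
  \<open>u\<close> is the constant extension of its truncation plus nonnegative multiples of unit vectors.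
\<close>

section \<open>Conic hulls\<close>

lemma cn_zero: "(\<lambda>i. 0) \<in> cn A"
  unfolding cn_def by (rule CollectI, rule exI[of _ "{}"]) simp

lemma cn_base: "a \<in> A \<Longrightarrow> a \<in> cn A"
  unfolding cn_def by (rule CollectI, rule exI[of _ "{a}"], rule exI[of _ "\<lambda>_. 1"]) simp

lemma cn_scale:
  assumes "x \<in> cn A" "0 \<le> (k::real)"
  shows "(\<lambda>i. k * x i) \<in> cn A"
proof -
  obtain S c where "finite S" "S \<subseteq> A" "\<forall>a\<in>S. 0 \<le> c a" "x = (\<lambda>i. \<Sum>a\<in>S. c a * a i)"
    using assms unfolding cn_def by blast
  then show ?thesis
    unfolding cn_def using assms(2)
    by (intro CollectI exI[of _ S] exI[of _ "\<lambda>a. k * c a"])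
       (auto simp: sum_distrib_left mult.assoc)
qed

lemma cn_add:
  assumes "x \<in> cn A" "y \<in> cn A"
  shows "(\<lambda>i. x i + y i) \<in> cn A"
proof -
  obtain S c where S: "finite S" "S \<subseteq> A" "\<forall>a\<in>S. 0 \<le> c a" "x = (\<lambda>i. \<Sum>a\<in>S. c a * a i)"
    using assms unfolding cn_def by blast
  obtain T d where T: "finite T" "T \<subseteq> A" "\<forall>a\<in>T. 0 \<le> d a" "y = (\<lambda>i. \<Sum>a\<in>T. d a * a i)"
    using assms unfolding cn_def by blast
  \<comment> \<open>Each coefficient family is extended by 0 off its own set, so a generator in both
    \<open>S\<close> and \<open>T\<close> receives \<open>c a + d a\<close>.\<close>
  define e where "e a = (if a \<in> S then c a else 0) + (if a \<in> T then d a else 0)" for a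
  have "x i + y i = (\<Sum>a\<in>S \<union> T. e a * a i)" for i
  proof -
    have "x i = (\<Sum>a\<in>S \<union> T. (if a \<in> S then c a else 0) * a i)"
      unfolding S(4) using S(1) T(1) by (intro sum.mono_neutral_cong_left) auto
    moreover have "y i = (\<Sum>a\<in>S \<union> T. (if a \<in> T then d a else 0) * a i)"
      unfolding T(4) using S(1) T(1) by (intro sum.mono_neutral_cong_left) auto
    ultimately show ?thesis
      by (simp add: e_def distrib_right sum.distrib)
  qed
  then show ?thesis
    unfolding cn_def using S T
    by (intro CollectI exI[of _ "S \<union> T"] exI[of _ e]) (auto simp: e_def)
qed

text \<open>Finite nonnegative combinations arise from zero by scaling and adding generators.
  Properties of cones can thus be checked without handling coefficient families.\<close>

lemma cn_induct [consumes 1, case_names zero base add scale]: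
  assumes "x \<in> cn A"
    and zero: "P (\<lambda>i. 0)"
    and base: "\<And>a. a \<in> A \<Longrightarrow> P a"
    and add: "\<And>x y. P x \<Longrightarrow> P y \<Longrightarrow> P (\<lambda>i. x i + y i)"
    and scale: "\<And>k x. 0 \<le> k \<Longrightarrow> P x \<Longrightarrow> P (\<lambda>i. k * x i)"
  shows "P x"
proof -
  obtain S c where S: "finite S" "S \<subseteq> A" "\<forall>a\<in>S. 0 \<le> c a" "x = (\<lambda>i. \<Sum>a\<in>S. c a * a i)"
    using assms(1) unfolding cn_def by blast
  have "P (\<lambda>i. \<Sum>a\<in>S. c a * a i)"
    using S(1-3)
  proof (induction S rule: finite_induct)
    case empty
    then show ?case using zero by simp
  next
    case (insert a S)
    have "P (\<lambda>i. c a * a i)"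
      using insert by (intro scale base) auto
    moreover have "P (\<lambda>i. \<Sum>a\<in>S. c a * a i)" using insert by auto
    ultimately have "P (\<lambda>i. c a * a i + (\<Sum>a\<in>S. c a * a i))" by (rule add)
    then show ?case using insert by simp
  qed
  then show ?thesis using S(4) by simp
qed

lemma cn_sum:
  assumes "finite J" "\<And>j. j \<in> J \<Longrightarrow> x j \<in> cn A"
  shows "(\<lambda>i. \<Sum>j\<in>J. x j i) \<in> cn A"
  using assms by (induction J rule: finite_induct) (auto intro: cn_zero cn_add)

lemma cn_mono:
  assumes "x \<in> cn A" "A \<subseteq> cn B"
  shows "x \<in> cn B"
  using assms(1) by (induction rule: cn_induct) (use assms(2) in \<open>auto intro: cn_zero cn_add cn_scale\<close>)

section \<open>Polyhedral cones are finitely generated\<close>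

text \<open>The double description step: generators on the good side of the hyperplane
  \<open>f = 0\<close> are kept, and each pair on opposite sides is replaced by a positive
  combination lying on the hyperplane.\<close>

lemma cn_halfspace_finitely_generated:
  fixes f :: "(nat \<Rightarrow> real) \<Rightarrow> real"
  assumes "finite F"
    and add: "\<And>x y. f (\<lambda>i. x i + y i) = f x + f y"
    and scale: "\<And>k x. f (\<lambda>i. k * x i) = k * f x"
  shows "\<exists>G. finite G \<and> {u \<in> cn F. 0 \<le> f u} = cn G"
proof -
  define P where "P = {a \<in> F. 0 \<le> f a}"
  define N where "N = {a \<in> F. f a < 0}"
  define G where "G = P \<union> (\<lambda>(p, q) i. f p * q i - f q * p i) ` (P \<times> N)"
  have f0: "f (\<lambda>i. 0) = 0" using scale[of 0 "\<lambda>i. 0"] by simp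
  have fP: "0 \<le> f x" if "x \<in> cn P" for x
    using that by (induction rule: cn_induct) (auto simp: f0 add scale P_def)
  \<comment> \<open>Strictness survives in the cone over \<open>N\<close> except at the origin. This
    is what forces \<open>y\<close> to vanish below when \<open>f x = 0\<close> and
    \<open>f u\<close> is nonnegative.\<close>
  have fN: "y = (\<lambda>i. 0) \<or> f y < 0" if "y \<in> cn N" for y
    using that
  proof (induction rule: cn_induct)
    case (add x y)
    then show ?case using assms(2) by (auto simp: f0)
  next
    case (scale k x)
    then show ?case using assms(3) by (cases "k = 0") (auto simp: mult_less_0_iff)
  qed (auto simp: N_def)
  have split: "\<exists>x\<in>cn P. \<exists>y\<in>cn N. u = (\<lambda>i. x i + y i)" if "u \<in> cn F" for u
    using that
  proof (induction rule: cn_induct)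
    case zero
    show ?case by (rule bexI[OF _ cn_zero], rule bexI[OF _ cn_zero]) simp
  next
    case (base a)
    show ?case
    proof (cases "0 \<le> f a")
      case True
      with base have a: "a \<in> cn P" by (auto simp: P_def intro: cn_base)
      show ?thesis by (rule bexI[OF _ a], rule bexI[OF _ cn_zero]) simp
    next
      case False
      with base have a: "a \<in> cn N" by (auto simp: N_def intro: cn_base)
      show ?thesis by (rule bexI[OF _ cn_zero], rule bexI[OF _ a]) simp
    qed
  next
    case (add u v)
    then obtain x y x' y' where *: "x \<in> cn P" "y \<in> cn N" "x' \<in> cn P" "y' \<in> cn N"
      "u = (\<lambda>i. x i + y i)" "v = (\<lambda>i. x' i + y' i)" by blast
    show ?case
      by (rule bexI[OF _ cn_add[OF *(1,3)]], rule bexI[OF _ cn_add[OF *(2,4)]])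
         (simp add: * fun_eq_iff)
  next
    case (scale k u)
    then obtain x y where *: "x \<in> cn P" "y \<in> cn N" "u = (\<lambda>i. x i + y i)" by blast
    show ?case
      by (rule bexI[OF _ cn_scale[OF *(1) scale(1)]], rule bexI[OF _ cn_scale[OF *(2) scale(1)]])
         (simp add: * fun_eq_iff distrib_left)
  qed
  \<comment> \<open>The expression is bilinear in \<open>p\<close> and \<open>y\<close>, so
    membership in \<open>cn G\<close> passes from pairs of generators to pairs of cone elements, one
    argument at a time.\<close>
  have comb_base: "(\<lambda>i. f p * y i - f y * p i) \<in> cn G" if "p \<in> P" "y \<in> cn N" for p y
    using that(2)
  proof (induction rule: cn_induct)
    case zero
    show ?case by (simp add: f0 cn_zero)
  next
    case (base q)
    with that(1) show ?case unfolding G_def by (intro cn_base) force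
  next
    case (add x y)
    from cn_add[OF this] show ?case by (simp add: assms(2) algebra_simps)
  next
    case (scale k x)
    from cn_scale[OF scale(2,1)] show ?case by (simp add: assms(3) algebra_simps)
  qed
  have comb: "(\<lambda>i. f x * y i - f y * x i) \<in> cn G" if "x \<in> cn P" "y \<in> cn N" for x y
    using that(1)
  proof (induction rule: cn_induct)
    case zero
    show ?case by (simp add: f0 cn_zero)
  next
    case (base p)
    then show ?case using that(2) by (rule comb_base)
  next
    case (add x y)
    from cn_add[OF this] show ?case by (simp add: assms(2) algebra_simps)
  next
    case (scale k x)
    from cn_scale[OF scale(2,1)] show ?case by (simp add: assms(3) algebra_simps)
  qed
  have PG: "x \<in> cn G" if "x \<in> cn P" for x
    using that by (rule cn_mono) (auto simp: G_def intro: cn_base)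
  have "u \<in> cn G" if u: "u \<in> cn F" "0 \<le> f u" for u
  proof -
    obtain x y where xy: "x \<in> cn P" "y \<in> cn N" "u = (\<lambda>i. x i + y i)"
      using split[OF u(1)] by blast
    have fu: "f u = f x + f y" using xy(3) add by simp
    show ?thesis
    proof (cases "f x = 0")
      case True
      then have "y = (\<lambda>i. 0)" using fN[OF xy(2)] u(2) fu by auto
      then show ?thesis using PG[OF xy(1)] xy(3) by simp
    next
      case False
      then have pos: "0 < f x" using fP[OF xy(1)] by simp
      \<comment> \<open>All of \<open>y\<close> is absorbed into a point on the hyperplane. The
        leftover multiple of \<open>x\<close> is \<open>1 + f y / f x = f u / f x\<close>, which is
        nonnegative.\<close>
      have "(\<lambda>i. 1 / f x * (f x * y i - f y * x i) + (1 + f y / f x) * x i) \<in> cn G"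
        using pos u(2) fu
        by (intro cn_add cn_scale comb PG xy) (auto simp: field_simps)
      also have "(\<lambda>i. 1 / f x * (f x * y i - f y * x i) + (1 + f y / f x) * x i) = u"
        using pos xy(3) by (auto simp: fun_eq_iff field_simps)
      finally show ?thesis .
    qed
  qed
  moreover have "u \<in> cn F \<and> 0 \<le> f u" if "u \<in> cn G" for u
    using that
  proof (induction rule: cn_induct)
    case (base g)
    consider "g \<in> P" | p q where "p \<in> P" "q \<in> N" "g = (\<lambda>i. f p * q i - f q * p i)"
      using base unfolding G_def by auto
    then show ?case
    proof cases
      case 1
      then show ?thesis by (auto simp: P_def intro: cn_base)
    next
      case 2
      have g: "g = (\<lambda>i. f p * q i + (- f q) * p i)" using 2(3) by (simp add: fun_eq_iff)
      have "g \<in> cn F"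
        unfolding g using 2(1,2) by (intro cn_add cn_scale cn_base) (auto simp: P_def N_def)
      moreover have "f g = 0"
        unfolding g add scale by simp
      ultimately show ?thesis by simp
    qed
  qed (auto simp: f0 add scale intro: cn_zero cn_add cn_scale)
  moreover have "finite G"
    using assms(1) by (auto simp: G_def P_def N_def)
  ultimately show ?thesis by blast
qed

lemma Rn_eq_cn: "Rn n = cn ((\<lambda>i. unit_vec i) ` {1..n} \<union> (\<lambda>i j. - unit_vec i j) ` {1..n})"
  (is "_ = cn ?E")
proof (intro equalityI subsetI)
  fix u assume u: "u \<in> Rn n"
  have "(\<lambda>i. u j * unit_vec j i) \<in> cn ?E" if "j \<in> {1..n}" for j
  proof (cases "0 \<le> u j")
    case True
    then show ?thesis using that by (intro cn_scale cn_base) auto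
  next
    case False
    then have "(\<lambda>i. (- u j) * (- unit_vec j i)) \<in> cn ?E"
      using that by (intro cn_scale cn_base) auto
    then show ?thesis by simp
  qed
  then have "(\<lambda>i. \<Sum>j\<in>{1..n}. u j * unit_vec j i) \<in> cn ?E"
    by (intro cn_sum) auto
  also have "(\<lambda>i. \<Sum>j\<in>{1..n}. u j * unit_vec j i) = u"
    using u by (auto simp: unit_vec_def Rn_def fun_eq_iff if_distrib cong: if_cong)
  finally show "u \<in> cn ?E" .
next
  fix u assume "u \<in> cn ?E"
  then show "u \<in> Rn n"
    by (induction rule: cn_induct) (auto simp: Rn_def unit_vec_def)
qed

text \<open>Induction on the inequalities: the whole space is generated by the vectors plus or minus
  \<open>unit_vec i\<close>, and each further inequality is one halfspace cut.\<close>

lemma polyhedral_cone_finitely_generated: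
  assumes "finite A"
  shows "\<exists>F. finite F \<and> {u \<in> Rn n. \<forall>a\<in>A. 0 \<le> (\<Sum>i=1..n. u i * a i)} = cn F"
  using assms
proof (induction A rule: finite_induct)
  case empty
  show ?case by (intro exI conjI) (use Rn_eq_cn[of n] in auto)
next
  case (insert a A)
  then obtain F where F: "finite F"
    "{u \<in> Rn n. \<forall>a\<in>A. 0 \<le> (\<Sum>i=1..n. u i * a i)} = cn F" by blast
  obtain G where G: "finite G" "{u \<in> cn F. 0 \<le> (\<Sum>i=1..n. u i * a i)} = cn G"
    using cn_halfspace_finitely_generated[OF F(1), of "\<lambda>u. \<Sum>i=1..n. u i * a i"]
    by (auto simp: sum.distrib distrib_right sum_distrib_left mult.assoc)
  have "{u \<in> Rn n. \<forall>b\<in>insert a A. 0 \<le> (\<Sum>i=1..n. u i * b i)} = cn G"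
    unfolding G(2)[symmetric] F(2)[symmetric] by auto
  with G(1) show ?case by blast
qed

text \<open>Pairing with \<open>u\<close> is linear, so it is nonnegative on a cone once it is so on
  the generators. For finite \<open>A\<close> this makes the dual polyhedral.\<close>

lemma dual_cone_cn:
  "dual_cone n (cn A) = {u \<in> Rn n. \<forall>a\<in>A. 0 \<le> (\<Sum>i=1..n. u i * a i)}"
proof -
  have "0 \<le> (\<Sum>i=1..n. u i * v i)"
    if "\<forall>a\<in>A. 0 \<le> (\<Sum>i=1..n. u i * a i)" "v \<in> cn A" for u v
    using that(2)
  proof (induction rule: cn_induct)
    case (scale k x)
    have "(\<Sum>i=1..n. u i * (k * x i)) = k * (\<Sum>i=1..n. u i * x i)"
      by (simp add: sum_distrib_left mult.left_commute)
    with scale show ?case by simp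
  qed (use that(1) in \<open>auto simp: distrib_left sum.distrib\<close>)
  then show ?thesis unfolding dual_cone_def by (auto intro: cn_base)
qed

text \<open>Sortedness reduces to comparing neighbours, and each comparison is a pairing with a
  difference of consecutive unit vectors. It thus only adds finitely many inequalities to those
  defining the dual.\<close>

lemma sorted_dual_cone_finitely_generated:
  assumes "fg_cone r K"
  shows "\<exists>F. finite F \<and>
    {u \<in> dual_cone r K. \<forall>i j. 1 \<le> i \<and> i \<le> j \<and> j \<le> r \<longrightarrow> u i \<le> u j} = cn F"
proof -
  obtain A where A: "finite A" "K = cn A" using assms unfolding fg_cone_def by blast
  define d where "d i = (\<lambda>j. unit_vec (Suc i) j - unit_vec i j)" for i
  have d: "(\<Sum>j=1..r. u j * d i j) = u (Suc i) - u i" if "i \<in> {1..<r}" for i and u :: "nat \<Rightarrow> real"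
  proof -
    have "(\<Sum>j=1..r. u j * d i j) =
        (\<Sum>j=1..r. if j = Suc i then u j else 0) - (\<Sum>j=1..r. if j = i then u j else 0)"
      unfolding sum_subtractf[symmetric] by (intro sum.cong) (auto simp: d_def unit_vec_def)
    then show ?thesis using that by simp
  qed
  have sorted: "(\<forall>i j. 1 \<le> i \<and> i \<le> j \<and> j \<le> r \<longrightarrow> u i \<le> u j) \<longleftrightarrow>
      (\<forall>i\<in>{1..<r}. u i \<le> u (Suc i))" for u :: "nat \<Rightarrow> real"
  proof (intro iffI allI impI)
    fix i j assume step: "\<forall>i\<in>{1..<r}. u i \<le> u (Suc i)" and "1 \<le> i \<and> i \<le> j \<and> j \<le> r"
    then have "i \<le> j" "1 \<le> i" "j \<le> r" by auto
    then show "u i \<le> u j"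
    proof (induction j rule: dec_induct)
      case (step k)
      then show ?case using \<open>\<forall>i\<in>{1..<r}. u i \<le> u (Suc i)\<close>
        by (auto intro: order_trans)
    qed simp
  qed auto
  have steps: "(\<forall>a\<in>d ` {1..<r}. 0 \<le> (\<Sum>j=1..r. u j * a j)) \<longleftrightarrow>
      (\<forall>i\<in>{1..<r}. u i \<le> u (Suc i))" for u :: "nat \<Rightarrow> real"
    unfolding ball_simps by (intro ball_cong refl, subst d) auto
  have "{u \<in> dual_cone r K. \<forall>i j. 1 \<le> i \<and> i \<le> j \<and> j \<le> r \<longrightarrow> u i \<le> u j} =
      {u \<in> Rn r. \<forall>a\<in>A \<union> d ` {1..<r}. 0 \<le> (\<Sum>i=1..r. u i * a i)}"
    unfolding sorted A(2) dual_cone_cn ball_Un steps by blast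
  then show ?thesis
    using polyhedral_cone_finitely_generated[of "A \<union> d ` {1..<r}" r] A(1) by auto
qed

section \<open>Permutations\<close>

lemma Sym_intro: "\<sigma> permutes {1..n} \<Longrightarrow> a \<in> A \<Longrightarrow> (\<lambda>i. a (inv \<sigma> i)) \<in> Sym n A"
  unfolding Sym_def by blast

lemma subset_Sym: "A \<subseteq> Sym n A"
  using Sym_intro[OF permutes_id, of _ A n] by auto

lemma Sym_permuted:
  assumes "x \<in> Sym n A" "\<sigma> permutes {1..n}"
  shows "(\<lambda>i. x (inv \<sigma> i)) \<in> Sym n A"
proof -
  obtain \<tau> a where \<tau>: "\<tau> permutes {1..n}" "a \<in> A" "x = (\<lambda>i. a (inv \<tau> i))"
    using assms(1) unfolding Sym_def by blast
  have "(\<lambda>i. x (inv \<sigma> i)) = (\<lambda>i. a (inv (\<sigma> \<circ> \<tau>) i))"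
    using \<tau> assms(2) by (simp add: o_inv_distrib permutes_bij)
  then show ?thesis
    using Sym_intro[OF permutes_compose[OF \<tau>(1) assms(2)] \<tau>(2)] by simp
qed

lemma cn_Sym_permuted:
  assumes "x \<in> cn (Sym n A)" "\<sigma> permutes {1..n}"
  shows "(\<lambda>i. x (inv \<sigma> i)) \<in> cn (Sym n A)"
  using assms(1)
  by (induction rule: cn_induct)
     (auto intro: cn_zero cn_add cn_scale cn_base Sym_permuted[OF _ assms(2)])

lemma sum_permuted_right:
  fixes u v :: "nat \<Rightarrow> real"
  assumes "\<sigma> permutes {1..n}"
  shows "(\<Sum>i=1..n. u i * v (inv \<sigma> i)) = (\<Sum>i=1..n. u (\<sigma> i) * v i)"
proof -
  have "(\<Sum>i=1..n. u i * v (inv \<sigma> i)) = (\<Sum>i=1..n. u (\<sigma> i) * v (inv \<sigma> (\<sigma> i)))"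
    using sum.permute[OF assms, of "\<lambda>i. u i * v (inv \<sigma> i)"] by (simp add: o_def)
  then show ?thesis using assms by (simp add: permutes_inverses)
qed

lemma Rn_permuted:
  assumes "u \<in> Rn n" "\<sigma> permutes {1..n}"
  shows "(\<lambda>i. u (\<sigma> i)) \<in> Rn n"
  using assms by (auto simp: Rn_def permutes_not_in)

text \<open>Reindexing moves \<open>\<sigma>\<close> to the other factor of the pairing, where it is
  harmless because \<open>K\<close> is closed under permutations.\<close>

lemma dual_cone_permuted:
  assumes u: "u \<in> dual_cone n K" and K: "K = cn (Sym n A)" and \<sigma>: "\<sigma> permutes {1..n}"
  shows "(\<lambda>i. u (\<sigma> i)) \<in> dual_cone n K"
proof -
  have "0 \<le> (\<Sum>i=1..n. u (\<sigma> i) * v i)" if "v \<in> K" for v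
    using cn_Sym_permuted[of v n A \<sigma>] that u \<sigma> K
    unfolding sum_permuted_right[OF \<sigma>, symmetric] dual_cone_def by auto
  then show ?thesis using u Rn_permuted[OF _ \<sigma>] by (auto simp: dual_cone_def)
qed

lemma ex_sorting_permutation:
  fixes u :: "nat \<Rightarrow> real"
  shows "\<exists>\<sigma>. \<sigma> permutes {1..n} \<and>
    (\<forall>i j. 1 \<le> i \<and> i \<le> j \<and> j \<le> n \<longrightarrow> u (\<sigma> i) \<le> u (\<sigma> j))"
proof -
  \<comment> \<open>A permutation maximising this weight is sorting, since swapping a descent increases it.\<close>
  define \<Phi> where "\<Phi> \<sigma> = (\<Sum>k=1..n. real k * u (\<sigma> k))" for \<sigma>
  have fin: "finite {\<sigma>. \<sigma> permutes {1..n}}" by (simp add: finite_permutations)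
  have ne: "{\<sigma>. \<sigma> permutes {1..n}} \<noteq> {}" using permutes_id by blast
  obtain \<sigma> where \<sigma>: "\<sigma> permutes {1..n}" and max: "\<And>\<tau>. \<tau> permutes {1..n} \<Longrightarrow> \<Phi> \<tau> \<le> \<Phi> \<sigma>"
    using obtains_MAX[OF fin ne, of \<Phi>] Max_ge[of "\<Phi> ` {\<sigma>. \<sigma> permutes {1..n}}"] fin
    by (metis (mono_tags, lifting) finite_imageI imageI mem_Collect_eq)
  have "u (\<sigma> i) \<le> u (\<sigma> j)" if ij: "1 \<le> i \<and> i \<le> j \<and> j \<le> n" for i j
  proof (rule ccontr)
    assume less: "\<not> u (\<sigma> i) \<le> u (\<sigma> j)"
    then have "i < j" using ij by (cases "i = j") auto
    define \<tau> where "\<tau> = \<sigma> \<circ> transpose i j"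
    have "\<tau> permutes {1..n}"
      unfolding \<tau>_def using ij by (intro permutes_compose \<sigma> permutes_swap_id) auto
    then have le: "\<Phi> \<tau> \<le> \<Phi> \<sigma>" by (rule max)
    have split: "\<Phi> \<rho> = real i * u (\<rho> i) + (real j * u (\<rho> j) +
        (\<Sum>k\<in>{1..n} - {i} - {j}. real k * u (\<rho> k)))" for \<rho>
      unfolding \<Phi>_def using ij \<open>i < j\<close>
      by (subst sum.remove[of _ i], simp, simp, subst sum.remove[of _ j]) auto
    have rest: "(\<Sum>k\<in>{1..n} - {i} - {j}. real k * u (\<tau> k)) =
        (\<Sum>k\<in>{1..n} - {i} - {j}. real k * u (\<sigma> k))"
      by (intro sum.cong) (auto simp: \<tau>_def transpose_def)
    have "\<Phi> \<tau> - \<Phi> \<sigma> = (real j - real i) * (u (\<sigma> i) - u (\<sigma> j))"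
      unfolding split rest by (simp add: \<tau>_def algebra_simps)
    moreover have "0 < \<dots>" using \<open>i < j\<close> less by simp
    ultimately show False using le by simp
  qed
  with \<sigma> show ?thesis by blast
qed

text \<open>Among distinct positive integers, the one of rank \<open>k\<close> is at least
  \<open>k\<close>, so passing to ranks only lowers values. This moves the positions occupied by
  \<open>r\<close> entries back into the first \<open>r\<close> places.\<close>

lemma ex_permutation_le_inj:
  fixes \<sigma> :: "nat \<Rightarrow> nat"
  assumes inj: "inj_on \<sigma> {1..r}" and pos: "\<And>i. i \<in> {1..r} \<Longrightarrow> 1 \<le> \<sigma> i"
  shows "\<exists>\<tau>. \<tau> permutes {1..r} \<and> (\<forall>i\<in>{1..r}. \<tau> i \<le> \<sigma> i)"
proof -
  \<comment> \<open>The rank of \<open>\<sigma> i\<close> among the values of \<open>\<sigma>\<close>.\<close>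
  define L where "L i = {j \<in> {1..r}. \<sigma> j \<le> \<sigma> i}" for i
  \<comment> \<open>The identity outside \<open>{1..r}\<close> is what makes \<open>\<tau>\<close> a
    permutation in the sense of \<open>permutes\<close>.\<close>
  define \<tau> where "\<tau> i = (if i \<in> {1..r} then card (L i) else i)" for i
  have fin: "finite (L i)" for i by (simp add: L_def)
  have lt: "card (L i) < card (L j)" if "i \<in> {1..r}" "j \<in> {1..r}" "\<sigma> i < \<sigma> j" for i j
  proof (rule psubset_card_mono[OF fin])
    have "L i \<subseteq> L j" "j \<in> L j" "j \<notin> L i" using that by (auto simp: L_def)
    then show "L i \<subset> L j" by blast
  qed
  have "inj_on (\<lambda>i. card (L i)) {1..r}"
  proof (rule inj_onI)
    fix i j assume ij: "i \<in> {1..r}" "j \<in> {1..r}" "card (L i) = card (L j)"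
    then have "\<sigma> i = \<sigma> j"
      using lt[of i j] lt[of j i] by (cases "\<sigma> i" "\<sigma> j" rule: linorder_cases) auto
    then show "i = j" using inj ij by (auto dest: inj_onD)
  qed
  moreover have "inj_on \<tau> {1..r} \<longleftrightarrow> inj_on (\<lambda>i. card (L i)) {1..r}"
    by (rule inj_on_cong) (simp only: \<tau>_def if_True)
  ultimately have "inj_on \<tau> {1..r}" by (simp only:)
  moreover have "\<tau> ` {1..r} \<subseteq> {1..r}"
  proof (intro image_subsetI)
    fix i assume i: "i \<in> {1..r}"
    then have "i \<in> L i" by (simp add: L_def)
    then have "0 < card (L i)" using fin card_gt_0_iff by blast
    moreover have "card (L i) \<le> card {1..r}" by (intro card_mono) (auto simp: L_def)
    ultimately show "\<tau> i \<in> {1..r}" using i by (simp add: \<tau>_def)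
  qed
  ultimately have "bij_betw \<tau> {1..r} {1..r}"
    by (simp add: bij_betw_def endo_inj_surj)
  then have "\<tau> permutes {1..r}" by (rule bij_imp_permutes) (auto simp: \<tau>_def)
  moreover have "\<tau> i \<le> \<sigma> i" if "i \<in> {1..r}" for i
  proof -
    \<comment> \<open>The rank counts distinct values of \<open>\<sigma>\<close> lying in
      \<open>{1..\<sigma> i}\<close>.\<close>
    have "card (L i) = card (\<sigma> ` L i)"
      by (rule card_image[symmetric], rule inj_on_subset[OF inj]) (auto simp: L_def)
    also have "\<dots> \<le> card {1..\<sigma> i}"
      using pos by (intro card_mono) (auto simp: L_def)
    finally show ?thesis using that by (simp add: \<tau>_def)
  qed
  ultimately show ?thesis by blast
qed

section \<open>Sorted vectors of the dual cones\<close>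

lemma sum_upto_support:
  fixes u v :: "nat \<Rightarrow> real"
  assumes "v \<in> Rn r" "r \<le> n"
  shows "(\<Sum>i=1..n. u i * v i) = (\<Sum>i=1..r. u i * v i)"
  using assms by (intro sum.mono_neutral_right) (auto simp: Rn_def)

text \<open>A rearranged \<open>v\<close> sits at distinct positions of \<open>{1..n}\<close>.
  Replacing these by their ranks lowers the entries of \<open>u\<close> met there, and since
  \<open>v\<close> is nonnegative the pairing drops to one with a rearrangement within the first
  \<open>r\<close> places. The equation for \<open>K\<close> keeps that rearrangement in
  \<open>K\<close>.\<close>

lemma sorted_mem_dual_cone:
  assumes u: "u \<in> Rn n" and sorted: "\<And>i j. 1 \<le> i \<Longrightarrow> i \<le> j \<Longrightarrow> j \<le> n \<Longrightarrow> u i \<le> u j"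
    and "r \<le> n" and K: "K = cn (Sym r K)" "K \<subseteq> Rn_nonneg r"
    and first: "\<And>v. v \<in> K \<Longrightarrow> 0 \<le> (\<Sum>i=1..r. u i * v i)"
  shows "u \<in> dual_cone n (cn (Sym n K))"
  unfolding dual_cone_cn
proof (intro CollectI conjI ballI)
  show "u \<in> Rn n" by (rule u)
  fix x assume "x \<in> Sym n K"
  then obtain \<sigma> v where \<sigma>: "\<sigma> permutes {1..n}" and v: "v \<in> K" and x: "x = (\<lambda>i. v (inv \<sigma> i))"
    unfolding Sym_def by blast
  have v0: "v \<in> Rn r" "\<And>i. i \<in> {1..r} \<Longrightarrow> 0 \<le> v i"
    using v K(2) by (auto simp: Rn_nonneg_def)
  have \<sigma>_in: "\<sigma> i \<in> {1..n}" if "i \<in> {1..r}" for i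
    using permutes_in_image[OF \<sigma>, of i] that \<open>r \<le> n\<close> by auto
  obtain \<tau> where \<tau>: "\<tau> permutes {1..r}" "\<And>i. i \<in> {1..r} \<Longrightarrow> \<tau> i \<le> \<sigma> i"
    using ex_permutation_le_inj[of \<sigma> r] \<sigma>_in permutes_inj_on[OF \<sigma>] by auto
  have \<tau>_in: "\<tau> i \<in> {1..r}" if "i \<in> {1..r}" for i
    using permutes_in_image[OF \<tau>(1), of i] that by auto
  have "(\<lambda>i. v (inv \<tau> i)) \<in> K"
    using Sym_intro[OF \<tau>(1) v] K(1) cn_base by blast
  then have "0 \<le> (\<Sum>i=1..r. u i * v (inv \<tau> i))" by (rule first)
  also have "\<dots> = (\<Sum>i=1..r. u (\<tau> i) * v i)" by (rule sum_permuted_right[OF \<tau>(1)])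
  \<comment> \<open>Monotonicity of \<open>u\<close> is applied to
    \<open>\<tau> i \<le> \<sigma> i\<close>, weighted by the nonnegative
    \<open>v i\<close>.\<close>
  also have "\<dots> \<le> (\<Sum>i=1..r. u (\<sigma> i) * v i)"
  proof (intro sum_mono mult_right_mono sorted)
    fix i assume i: "i \<in> {1..r}"
    show "1 \<le> \<tau> i" "\<tau> i \<le> \<sigma> i" "\<sigma> i \<le> n" "0 \<le> v i"
      using \<tau>_in[OF i] \<tau>(2)[OF i] \<sigma>_in[OF i] v0(2)[OF i] by auto
  qed
  also have "\<dots> = (\<Sum>i=1..n. u (\<sigma> i) * v i)"
    by (rule sum_upto_support[OF v0(1) \<open>r \<le> n\<close>, symmetric])
  also have "\<dots> = (\<Sum>i=1..n. u i * x i)"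
    unfolding x by (rule sum_permuted_right[OF \<sigma>, symmetric])
  finally show "0 \<le> (\<Sum>i=1..n. u i * x i)" .
qed

text \<open>Constant extension is linear, so it carries nonnegative combinations to nonnegative
  combinations with the same coefficients.\<close>

lemma extend_last_cn:
  assumes "u \<in> cn F"
  shows "extend_last r n u \<in> cn (extend_last r n ` F)"
  using assms
proof (induction rule: cn_induct)
  case zero
  have "extend_last r n (\<lambda>i. 0) = (\<lambda>i. 0)" by (simp add: extend_last_def fun_eq_iff)
  then show ?case using cn_zero by simp
next
  case (base a)
  then show ?case by (auto intro: cn_base)
next
  case (add x y)
  have "extend_last r n (\<lambda>i. x i + y i) = (\<lambda>i. extend_last r n x i + extend_last r n y i)"
    by (simp add: extend_last_def fun_eq_iff)
  then show ?case using cn_add[OF add] by simp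
next
  case (scale k x)
  have "extend_last r n (\<lambda>i. k * x i) = (\<lambda>i. k * extend_last r n x i)"
    by (simp add: extend_last_def fun_eq_iff)
  then show ?case using cn_scale[OF scale(2,1)] by simp
qed

lemma unit_vec_in_Sym:
  assumes "1 \<le> j" "j \<le> n" "unit_vec n \<in> A"
  shows "unit_vec j \<in> Sym n A"
proof -
  have "transpose j n permutes {1..n}" using assms by (intro permutes_swap_id) auto
  from Sym_intro[OF this assms(3)]
  have "(\<lambda>i. unit_vec n (transpose j n i)) \<in> Sym n A" by simp
  also have "(\<lambda>i. unit_vec n (transpose j n i)) = unit_vec j"
    by (auto simp: unit_vec_def transpose_def fun_eq_iff)
  finally show ?thesis .
qed

section \<open>Dual cones along a stabilizing chain\<close>

theorem theorem4p4:
  fixes C :: "nat \<Rightarrow> (nat \<Rightarrow> real) set" and r :: nat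
  assumes fg: "\<And>n. 1 \<le> n \<Longrightarrow> fg_cone n (C n)"
    and nonneg: "\<And>n. 1 \<le> n \<Longrightarrow> C n \<subseteq> Rn_nonneg n"
    and inv: "sym_invariant C"
    and stab: "stabilizes C"
    and r: "r = stability_index C"
  shows "\<exists>F. finite F \<and> F \<subseteq> dual_cone r (C r) \<and>
           (\<forall>u\<in>F. \<forall>i j. 1 \<le> i \<and> i \<le> j \<and> j \<le> r \<longrightarrow> u i \<le> u j) \<and>
           (\<forall>n\<ge>r. dual_cone n (C n) = cn (Sym n (extend_last r n ` F \<union> {unit_vec n})))"
proof -
  have "stable_from C r"
    using stab unfolding stabilizes_def r stability_index_def by (auto intro: LeastI)
  then have r1: "1 \<le> r" and C: "\<And>n. r \<le> n \<Longrightarrow> C n = cn (Sym n (C r))"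
    unfolding stable_from_def by auto
  have Cr: "C r \<subseteq> Rn_nonneg r" using nonneg r1 by simp
  define D where
    "D = {u \<in> dual_cone r (C r). \<forall>i j. 1 \<le> i \<and> i \<le> j \<and> j \<le> r \<longrightarrow> u i \<le> u j}"
  \<comment> \<open>\<open>F\<close> depends on \<open>r\<close> alone and is fixed before
    \<open>n\<close>, so one finite set serves every \<open>n \<ge> r\<close>.\<close>
  obtain F where F: "finite F" "D = cn F"
    using sorted_dual_cone_finitely_generated[OF fg[OF r1]] unfolding D_def by blast
  have FD: "F \<subseteq> D" using F(2) by (auto intro: cn_base)
  have "dual_cone n (C n) = cn (Sym n (extend_last r n ` F \<union> {unit_vec n}))" (is "_ = cn (Sym n ?G)")
    if n: "r \<le> n" for n
  proof (intro equalityI subsetI)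
    fix u assume u: "u \<in> dual_cone n (C n)"
    \<comment> \<open>It suffices to treat the sorted rearrangement \<open>w\<close> of
      \<open>u\<close>: it stays in the dual, and permuting back at the end recovers
      \<open>u\<close>.\<close>
    obtain \<sigma> where \<sigma>: "\<sigma> permutes {1..n}"
      and sorted: "\<And>i j. 1 \<le> i \<Longrightarrow> i \<le> j \<Longrightarrow> j \<le> n \<Longrightarrow> u (\<sigma> i) \<le> u (\<sigma> j)"
      using ex_sorting_permutation[of n u] by blast
    define w where "w = (\<lambda>i. u (\<sigma> i))"
    have w: "w \<in> dual_cone n (C n)"
      unfolding w_def by (rule dual_cone_permuted[OF u C[OF n] \<sigma>])
    \<comment> \<open>Zeros beyond \<open>r\<close> put \<open>t\<close> in \<open>Rn r\<close>; its
      constant extension agrees with \<open>w\<close> up to index \<open>r\<close> and equals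
      \<open>w r\<close> from there to \<open>n\<close>.\<close>
    define t where "t = (\<lambda>i. if i \<in> {1..r} then w i else 0)"
    have "0 \<le> (\<Sum>i=1..r. t i * v i)" if v: "v \<in> C r" for v
    proof -
      \<comment> \<open>Padded with zeros, \<open>v\<close> already lies in \<open>C n\<close>, so
        testing \<open>w\<close> against \<open>v\<close> involves only the first \<open>r\<close>
        entries of \<open>w\<close>.\<close>
      have "v \<in> C n" using v C[OF n] subset_Sym cn_base by blast
      then have "0 \<le> (\<Sum>i=1..n. w i * v i)" using w by (auto simp: dual_cone_def)
      also have "\<dots> = (\<Sum>i=1..r. w i * v i)"
        using v Cr n by (intro sum_upto_support) (auto simp: Rn_nonneg_def)
      also have "\<dots> = (\<Sum>i=1..r. t i * v i)" by (intro sum.cong) (auto simp: t_def)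
      finally show ?thesis .
    qed
    then have "t \<in> D"
      using sorted n by (auto simp: D_def dual_cone_def Rn_def t_def w_def)
    then have "extend_last r n t \<in> cn (extend_last r n ` F)"
      unfolding F(2) by (rule extend_last_cn)
    then have t: "extend_last r n t \<in> cn (Sym n ?G)"
      by (rule cn_mono) (use subset_Sym[of ?G n] in \<open>auto intro: cn_base\<close>)
    \<comment> \<open>The excess of \<open>w\<close> over the constant tail is
      \<open>w j - w r\<close>, nonnegative by sorting; here \<open>1 \<le> r\<close> ensures that
      \<open>w r\<close> is a genuine coordinate.\<close>
    have "(\<lambda>i. extend_last r n t i + (\<Sum>j\<in>{r<..n}. (w j - w r) * unit_vec j i)) \<in> cn (Sym n ?G)"
    proof (intro cn_add t cn_sum cn_scale cn_base)
      fix j assume j: "j \<in> {r<..n}"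
      show "unit_vec j \<in> Sym n ?G" using j by (intro unit_vec_in_Sym) auto
      show "0 \<le> w j - w r" using sorted[of r j] j r1 by (simp add: w_def)
    qed simp
    also have "(\<lambda>i. extend_last r n t i + (\<Sum>j\<in>{r<..n}. (w j - w r) * unit_vec j i)) = w"
    proof
      fix i
      have "(\<Sum>j\<in>{r<..n}. (w j - w r) * unit_vec j i) = (if i \<in> {r<..n} then w i - w r else 0)"
        by (simp add: unit_vec_def if_distrib cong: if_cong)
      moreover have "w i = 0" if "i \<notin> {1..n}"
        using w that by (auto simp: dual_cone_def Rn_def)
      ultimately show "extend_last r n t i + (\<Sum>j\<in>{r<..n}. (w j - w r) * unit_vec j i) = w i"
        using r1 n by (auto simp: extend_last_def t_def)
    qed
    finally have "(\<lambda>i. w (inv \<sigma> i)) \<in> cn (Sym n ?G)"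
      by (rule cn_Sym_permuted[OF _ \<sigma>])
    then show "u \<in> cn (Sym n ?G)"
      using \<sigma> by (simp add: w_def permutes_inverses)
  next
    \<comment> \<open>For the reverse inclusion only unpermuted generators need checking, as the
      dual is a cone closed under permutations.\<close>
    have gen: "g \<in> dual_cone n (C n)" if "g \<in> ?G" for g
      using that
    proof
      assume "g \<in> extend_last r n ` F"
      then obtain f where f: "f \<in> D" and g: "g = extend_last r n f" using FD by blast
      have f': "f \<in> Rn r" "\<And>v. v \<in> C r \<Longrightarrow> 0 \<le> (\<Sum>i=1..r. f i * v i)"
        and fs: "\<And>i j. 1 \<le> i \<Longrightarrow> i \<le> j \<Longrightarrow> j \<le> r \<Longrightarrow> f i \<le> f j"
        using f by (auto simp: D_def dual_cone_def)
      show ?thesis unfolding C[OF n]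
      \<comment> \<open>Stability at \<open>n = r\<close> supplies the symmetry of
        \<open>C r\<close>, and the first \<open>r\<close> entries of \<open>g\<close> are those of
        \<open>f\<close>.\<close>
      proof (rule sorted_mem_dual_cone[OF _ _ n C[OF order_refl] Cr])
        show "g \<in> Rn n" using f'(1) n by (auto simp: g Rn_def extend_last_def)
        show "g i \<le> g j" if "1 \<le> i" "i \<le> j" "j \<le> n" for i j
          using that fs r1 by (auto simp: g extend_last_def)
        show "0 \<le> (\<Sum>i=1..r. g i * v i)" if "v \<in> C r" for v
          using f'(2)[OF that] by (simp add: g extend_last_def)
      qed
    next
      assume "g \<in> {unit_vec n}"
      then show ?thesis
        using nonneg[of n] n r1
        by (auto simp: dual_cone_def unit_vec_def Rn_def Rn_nonneg_def subset_iff intro!: sum_nonneg)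
    qed
    fix u assume "u \<in> cn (Sym n ?G)"
    then show "u \<in> dual_cone n (C n)"
    proof (induction rule: cn_induct)
      case (base a)
      then obtain \<sigma> g where \<sigma>: "\<sigma> permutes {1..n}" "g \<in> ?G" "a = (\<lambda>i. g (inv \<sigma> i))"
        unfolding Sym_def by blast
      \<comment> \<open>\<open>Sym\<close> acts through \<open>inv \<sigma>\<close>, whereas
        \<open>dual_cone_permuted\<close> composes with the permutation itself, so it is applied to
        the inverse.\<close>
      show ?case unfolding \<sigma>(3)
        by (rule dual_cone_permuted[OF gen[OF \<sigma>(2)] C[OF n] permutes_inv[OF \<sigma>(1)]])
    qed (auto simp: dual_cone_def Rn_def distrib_right sum.distrib mult.assoc
          simp flip: sum_distrib_left)
  qed
  then show ?thesis using F(1) FD by (intro exI[of _ F]) (auto simp: D_def)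
qed

end
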